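(* Let $(X,\mathrm{dist})$ be a compact metric space with infinitely many points and let $f\colon X\to X$ be an expansive homeomorphism. If $X$ is countable, then $f$ has doubly-asymptotic points, i.e. there exist $x\neq y$ in $X$ which are doubly-asymptotic.
   Context: A homeomorphism $f$ of a compact metric space $(X,\mathrm{dist})$ is expansive if there is a constant $c>0$ such that for all $x\neq y$ in $X$ there is $n\in\mathbb{Z}$ with $\mathrm{dist}(f^n(x),f^n(y))>c$. Points $x,y\in X$ are doubly-asymptotic if $\mathrm{dist}(f^n(x),f^n(y))\to0$ as $n\to\pm\infty$ (both as $n\to+\infty$ and as $n\to-\infty$). *)

theory Defs
  imports "HOL-Analysis.Analysis"
begin

text \<open>
  A compact metric space is a compact set \<open>X\<close> in a type of class \<open>metric_space\<close>, and a self-map of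
  it is a function on the ambient type of which only the values on \<open>X\<close> matter.
\<close>

text \<open>
  Integer iterates of a bijection \<open>f\<close> of \<open>X\<close>. The inverse is taken relative to \<open>X\<close>, since \<open>f\<close> need
  not be injective on the ambient type.
\<close>

definition int_iterate :: "'a set \<Rightarrow> ('a \<Rightarrow> 'a) \<Rightarrow> int \<Rightarrow> 'a \<Rightarrow> 'a" where
  "int_iterate X f n = (if 0 \<le> n then f ^^ nat n else inv_into X f ^^ nat (- n))"

definition self_homeomorphism :: "'a::metric_space set \<Rightarrow> ('a \<Rightarrow> 'a) \<Rightarrow> bool" where
  "self_homeomorphism X f \<longleftrightarrow> (\<exists>g. homeomorphism X X f g)"

definition expansive :: "'a::metric_space set \<Rightarrow> ('a \<Rightarrow> 'a) \<Rightarrow> bool" where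
  "expansive X f \<longleftrightarrow>
     (\<exists>c>0. \<forall>x\<in>X. \<forall>y\<in>X. x \<noteq> y \<longrightarrow>
        (\<exists>n::int. dist (int_iterate X f n x) (int_iterate X f n y) > c))"

definition doubly_asymptotic :: "'a::metric_space set \<Rightarrow> ('a \<Rightarrow> 'a) \<Rightarrow> 'a \<Rightarrow> 'a \<Rightarrow> bool" where
  "doubly_asymptotic X f x y \<longleftrightarrow>
     ((\<lambda>n::int. dist (int_iterate X f n x) (int_iterate X f n y)) \<longlongrightarrow> 0) at_top \<and>
     ((\<lambda>n::int. dist (int_iterate X f n x) (int_iterate X f n y)) \<longlongrightarrow> 0) at_bot"

end

theory Submission
  imports Defs
begin

text \<open>
  The points found are \<open>x\<close> and \<open>f\<^sup>m x\<close> for an isolated point \<open>x\<close> of a suitable subsystem \<open>M\<close>,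
  whose orbit approaches a finite set of periodic points in both time directions.

  Expansiveness supplies \<open>M\<close>. Near a finite invariant set there is no other complete orbit
  (\<open>expansive_isolates_finite_invariant_set\<close>), so a decreasing chain of infinite closed invariant
  sets cannot shrink to a finite set (\<open>infinite_subsystem_Inter\<close>), and Zorn's lemma gives a minimal
  infinite closed invariant set \<open>M\<close>. This replaces the last steps of a transfinite
  Cantor-Bendixson analysis. The set \<open>L\<close> of limit points of \<open>M\<close> is closed and invariant, and
  differs from \<open>M\<close> because a nonempty countable compact set has an isolated point. By minimality \<open>L\<close>
  is finite. An isolated point \<open>x\<close> of \<open>M\<close> is not periodic: deleting its finite orbit would leave
  a smaller infinite closed invariant set.

  Some \<open>f\<^sup>m\<close> with \<open>m > 0\<close> fixes every point of the finite set \<open>L\<close>. Outside a neighbourhood of \<open>L\<close>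
  there are only finitely many points of \<open>M\<close>, and the orbit of \<open>x\<close> visits each of them at most
  once. Hence \<open>f\<^sup>n x\<close> is close to some \<open>p\<close> in \<open>L\<close> for all but finitely many integers \<open>n\<close>, and then
  \<open>f\<^sup>m (f\<^sup>n x)\<close> is close to \<open>f\<^sup>m p = p\<close> too. So \<open>x\<close> and \<open>f\<^sup>m x\<close> are doubly asymptotic, and they are
  distinct because \<open>x\<close> is not periodic.
\<close>

section \<open>Integer iterates of a bijection\<close>

lemma int_iterate_mem:
  assumes "bij_betw f X X" "Y \<subseteq> X" "f ` Y = Y" "x \<in> Y"
  shows "int_iterate X f n x \<in> Y"
proof -
  have inv: "inv_into X f y \<in> Y" if "y \<in> Y" for y
  proof -
    from that obtain z where "z \<in> Y" "y = f z" using assms(3) by blast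
    then show ?thesis using assms(1,2) by (simp add: bij_betw_def inv_into_f_f subsetD)
  qed
  have "(f ^^ k) x \<in> Y" for k using assms(3,4) by (induction k) auto
  moreover have "(inv_into X f ^^ k) x \<in> Y" for k using assms(4) inv by (induction k) auto
  ultimately show ?thesis by (simp add: int_iterate_def)
qed

lemma int_iterate_in_space:
  assumes "bij_betw f X X" "x \<in> X"
  shows "int_iterate X f n x \<in> X"
  using int_iterate_mem[OF assms(1), of X] assms by (auto simp: bij_betw_def)

lemma int_iterate_add1:
  assumes "bij_betw f X X" "x \<in> X"
  shows "int_iterate X f (n + 1) x = f (int_iterate X f n x)"
proof (cases "0 \<le> n")
  case True
  then show ?thesis by (simp add: int_iterate_def nat_add_distrib)
next
  case False
  then obtain k where k: "n = - int (Suc k)"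
    by (metis linorder_not_less negD)
  have "(inv_into X f ^^ k) x \<in> X"
    using assms by (induction k) (auto simp: bij_betw_def inv_into_into)
  then have "f (inv_into X f ((inv_into X f ^^ k) x)) = (inv_into X f ^^ k) x"
    using assms by (simp add: bij_betw_def f_inv_into_f)
  then show ?thesis
    using k by (cases k) (auto simp: int_iterate_def nat_add_distrib)
qed

lemma int_iterate_zero [simp]: "int_iterate X f 0 x = x"
  by (simp add: int_iterate_def)

lemma int_iterate_add_nat:
  assumes "bij_betw f X X" "x \<in> X"
  shows "int_iterate X f (n + int k) x = (f ^^ k) (int_iterate X f n x)"
proof (induction k)
  case (Suc k)
  have "int_iterate X f (n + int (Suc k)) x = int_iterate X f (n + int k + 1) x"
    by (simp add: algebra_simps)
  with Suc show ?case by (simp add: int_iterate_add1[OF assms])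
qed simp

lemma int_iterate_commute:
  assumes "bij_betw f X X" "x \<in> X"
  shows "int_iterate X f n ((f ^^ k) x) = (f ^^ k) (int_iterate X f n x)"
proof -
  note mem = int_iterate_in_space[OF assms(1)]
  have X: "f y \<in> X" if "y \<in> X" for y using assms(1) that by (auto simp: bij_betw_def)
  have one: "int_iterate X f n (f y) = f (int_iterate X f n y)" if y: "y \<in> X" for y
  proof (induction n rule: int_induct[of _ 0])
    case (step1 i)
    then show ?case by (simp add: int_iterate_add1[OF assms(1)] y X)
  next
    case (step2 i)
    have "f (int_iterate X f (i - 1) (f y)) = f (f (int_iterate X f (i - 1) y))"
      using step2 int_iterate_add1[OF assms(1), of "f y" "i - 1"]
        int_iterate_add1[OF assms(1), of y "i - 1"] y X by simp
    then show ?case using assms(1) mem X y by (meson bij_betw_def inj_onD)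
  qed simp
  have "(f ^^ j) x \<in> X" for j using assms X by (induction j) auto
  then show ?thesis by (induction k) (auto simp: one)
qed

lemma inj_on_int_iterate:
  assumes "bij_betw f X X"
  shows "inj_on (int_iterate X f n) X"
proof (rule inj_onI)
  fix x y assume xy: "x \<in> X" "y \<in> X" "int_iterate X f n x = int_iterate X f n y"
  note mem = int_iterate_in_space[OF assms]
  have "int_iterate X f i x = int_iterate X f i y" for i
  proof (induction i rule: int_induct[of _ n])
    case (step1 i)
    then show ?case by (simp add: int_iterate_add1[OF assms] xy)
  next
    case (step2 i)
    have "f (int_iterate X f (i - 1) x) = f (int_iterate X f (i - 1) y)"
      using step2 int_iterate_add1[OF assms, of x "i - 1"]
        int_iterate_add1[OF assms, of y "i - 1"] xy by simp
    then show ?case using assms mem xy by (meson bij_betw_def inj_onD)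
  qed (use xy in simp)
  from this[of 0] show "x = y" by simp
qed

lemma inj_int_iterate_orbit:
  assumes "bij_betw f X X" "x \<in> X" and nonper: "\<And>k. k > 0 \<Longrightarrow> (f ^^ k) x \<noteq> x"
  shows "inj (\<lambda>n. int_iterate X f n x)"
proof -
  have X: "(f ^^ j) x \<in> X" for j using assms(1,2) by (induction j) (auto simp: bij_betw_def)
  have "int_iterate X f a x \<noteq> int_iterate X f b x" if ab: "a < b" for a b
  proof
    assume eq: "int_iterate X f a x = int_iterate X f b x"
    obtain k where k: "b = a + int k" "k > 0"
    proof
      show "b = a + int (nat (b - a))" "nat (b - a) > 0" using ab by auto
    qed
    have "int_iterate X f a ((f ^^ k) x) = int_iterate X f a x"
      using eq k(1) by (simp add: int_iterate_commute[OF assms(1,2)] int_iterate_add_nat[OF assms(1,2)])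
    then have "(f ^^ k) x = x"
      using inj_on_int_iterate[OF assms(1)] X assms(2) by (meson inj_onD)
    with nonper k show False by blast
  qed
  then show ?thesis by (metis injI linorder_neqE)
qed

text \<open>
  By pigeonhole, two different iterates of \<open>f\<close> agree on \<open>F\<close>; cancelling the smaller of the two
  exponents leaves an iterate that is the identity on \<open>F\<close>.
\<close>
lemma funpow_fixes_finite_set:
  assumes "finite F" "inj_on f F" "f ` F = F"
  shows "\<exists>m>0. \<forall>p\<in>F. (f ^^ m) p = p"
proof -
  have mem: "(f ^^ n) p \<in> F" if "p \<in> F" for n p using that assms(3) by (induction n) auto
  let ?R = "\<lambda>n. restrict (f ^^ n) F"
  have "range ?R \<subseteq> F \<rightarrow>\<^sub>E F" using mem by auto
  then have "finite (range ?R)" by (meson assms(1) finite_PiE finite_subset)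
  then have "\<not> inj ?R" using finite_imageD by blast
  then obtain a b where "a \<noteq> b" "?R a = ?R b" unfolding inj_def by blast
  then obtain i j where ij: "i < j" "?R i = ?R j"
    by (cases "a < b") (force, metis linorder_neqE_nat)
  have inj: "inj_on (f ^^ n) F" for n
  proof (induction n)
    case (Suc n)
    have "(f ^^ n) ` F \<subseteq> F" using mem by blast
    then have "inj_on f ((f ^^ n) ` F)" by (rule inj_on_subset[OF assms(2)])
    with Suc.IH have "inj_on (f \<circ> (f ^^ n)) F" by (rule comp_inj_on)
    then show ?case by (simp only: funpow.simps)
  qed simp
  have "(f ^^ (j - i)) p = p" if p: "p \<in> F" for p
  proof -
    have "(f ^^ i) ((f ^^ (j - i)) p) = (f ^^ j) p"
      using ij(1) by (metis comp_apply funpow_add le_add_diff_inverse less_imp_le_nat)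
    also have "\<dots> = (f ^^ i) p" using ij(2) p by (metis restrict_apply')
    finally show ?thesis using inj mem p by (meson inj_onD)
  qed
  then show ?thesis using ij(1) by (intro exI[of _ "j - i"]) auto
qed

section \<open>Limit points and compactness\<close>

text \<open>
  Injectivity is what keeps the images of an approximating sequence away from the image of its
  limit.
\<close>
lemma islimpt_image:
  fixes M :: "'a::metric_space set"
  assumes "continuous_on M h" "inj_on h M" "h ` M \<subseteq> M" "x \<in> M" "x islimpt M"
  shows "h x islimpt M"
proof -
  obtain s where s: "\<And>n::nat. s n \<in> M - {x}" "s \<longlonglongrightarrow> x"
    using assms(5) unfolding islimpt_sequential by blast
  have "(\<lambda>n. h (s n)) \<longlonglongrightarrow> h x"
    by (rule continuous_on_tendsto_compose[OF assms(1) s(2) assms(4)]) (use s in auto)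
  moreover have "h (s n) \<in> M - {h x}" for n
    using s(1)[of n] assms(2,3,4) by (auto dest: inj_onD)
  ultimately show ?thesis unfolding islimpt_sequential by (intro exI[of _ "\<lambda>n. h (s n)"]) auto
qed

lemma homeomorphism_imp_bij_betw:
  assumes "homeomorphism X Y f g"
  shows "bij_betw f X Y"
  using assms by (metis bij_betw_def homeomorphism_def inj_on_inverseI)

lemma homeomorphism_restrict_invariant:
  assumes "homeomorphism X X f g" "M \<subseteq> X" "f ` M = M"
  shows "homeomorphism M M f g"
  using assms homeomorphism_of_subsets by blast

lemma homeomorphism_limit_points:
  fixes M :: "'a::metric_space set"
  assumes "homeomorphism M M f g"
  shows "f ` {x \<in> M. x islimpt M} = {x \<in> M. x islimpt M}"
proof -
  have inj: "inj_on f M" "inj_on g M"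
    using assms homeomorphism_sym homeomorphism_imp_bij_betw bij_betw_imp_inj_on by metis+
  have sub: "f ` M \<subseteq> M" "g ` M \<subseteq> M" using assms by (auto simp: homeomorphism_def)
  have f: "f x islimpt M" if "x \<in> M" "x islimpt M" for x
    using islimpt_image[OF homeomorphism_cont1[OF assms] inj(1) sub(1)] that by blast
  have g: "g x islimpt M" if "x \<in> M" "x islimpt M" for x
    using islimpt_image[OF homeomorphism_cont2[OF assms] inj(2) sub(2)] that by blast
  show ?thesis
  proof
    show "f ` {x \<in> M. x islimpt M} \<subseteq> {x \<in> M. x islimpt M}" using f sub by auto
    show "{x \<in> M. x islimpt M} \<subseteq> f ` {x \<in> M. x islimpt M}"
    proof
      fix x assume "x \<in> {x \<in> M. x islimpt M}"
      then have "x = f (g x)" "g x \<in> {x \<in> M. x islimpt M}"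
        using g sub homeomorphism_apply2[OF assms] by auto
      then show "x \<in> f ` {x \<in> M. x islimpt M}" by blast
    qed
  qed
qed

text \<open>
  Otherwise \<open>M\<close> would be a nonempty perfect set in a locally compact Hausdorff space, and such a
  set has at least the cardinality of the continuum.
\<close>
lemma countable_compact_isolated_point:
  fixes M :: "'a::metric_space set"
  assumes "compact M" "countable M" "M \<noteq> {}"
  shows "\<exists>x\<in>M. \<not> x islimpt M"
proof (rule ccontr)
  assume "\<not> ?thesis"
  then have perfect: "(top_of_set M) derived_set_of M = M"
    by (fastforce simp: derived_set_of_def islimpt_def openin_open)
  have "locally_compact_space (top_of_set M)" "Hausdorff_space (top_of_set M)"
    using assms(1) by (auto intro: compact_imp_locally_compact_space Hausdorff_space_subtopology
        simp: compact_space_subtopology Hausdorff_space_euclidean)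
  then have "(UNIV::real set) \<lesssim> M"
    using lepoll_perfect_set[OF _ perfect assms(3)] by blast
  then show False
    using assms(2) countable_lepoll uncountable_UNIV_real by blast
qed

text \<open>
  The finite intersection property in the form needed below: if the intersection of a chain of
  closed sets lies in an open subset of a compact space, applying this to the complement \<open>K\<close> of that
  subset shows that some member of the chain lies in it already.
\<close>
lemma compact_chain_disjoint:
  fixes K :: "'a::topological_space set"
  assumes "compact K" "\<C> \<noteq> {}" "\<And>Y. Y \<in> \<C> \<Longrightarrow> closed Y"
    and chain: "\<And>Y Z. Y \<in> \<C> \<Longrightarrow> Z \<in> \<C> \<Longrightarrow> Y \<subseteq> Z \<or> Z \<subseteq> Y"
    and "K \<inter> \<Inter>\<C> = {}"
  shows "\<exists>Y\<in>\<C>. K \<inter> Y = {}"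
proof (rule ccontr)
  assume *: "\<not> ?thesis"
  have "K \<inter> \<Inter>\<D> \<noteq> {}" if "finite \<D>" "\<D> \<subseteq> \<C>" for \<D>
  proof -
    have "\<exists>Y\<in>\<C>. Y \<subseteq> \<Inter>\<D>"
      using that
    proof (induction \<D> rule: finite_induct)
      case empty then show ?case using assms(2) by auto
    next
      case (insert Z \<D>)
      then obtain Y where "Y \<in> \<C>" "Y \<subseteq> \<Inter>\<D>" "Z \<in> \<C>" by auto
      then show ?case using chain[of Y Z] by auto
    qed
    then obtain Y where "Y \<in> \<C>" "Y \<subseteq> \<Inter>\<D>" by blast
    moreover from * \<open>Y \<in> \<C>\<close> have "K \<inter> Y \<noteq> {}" by simp
    ultimately show ?thesis by blast
  qed
  with assms(1,3) have "K \<inter> \<Inter>\<C> \<noteq> {}" by (rule compact_imp_fip)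
  with assms(5) show False by blast
qed

section \<open>Expansiveness and minimal infinite subsystems\<close>

text \<open>
  If \<open>r\<close> is small compared with the gaps of \<open>F\<close>, an orbit that stays within \<open>r\<close> of \<open>F\<close> cannot
  switch from following one orbit in \<open>F\<close> to following another. It therefore stays within the
  expansiveness constant of a single orbit in \<open>F\<close>, and expansiveness identifies the two.
\<close>
lemma expansive_isolates_finite_invariant_set:
  fixes X :: "'a::metric_space set"
  assumes "compact X" "homeomorphism X X f g" "expansive X f"
    and F: "finite F" "F \<subseteq> X" "f ` F = F"
  shows "\<exists>r>0. \<forall>y\<in>X. (\<forall>n. \<exists>p\<in>F. dist (int_iterate X f n y) p < r) \<longrightarrow> y \<in> F"
proof -
  let ?T = "int_iterate X f"
  note bij = homeomorphism_imp_bij_betw[OF assms(2)]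
  note memX = int_iterate_in_space[OF bij]
  have memF: "?T n p \<in> F" if "p \<in> F" for n p
    using int_iterate_mem[OF bij F(2,3)] that by auto
  obtain c where c: "c > 0"
    "\<And>x y. x \<in> X \<Longrightarrow> y \<in> X \<Longrightarrow> x \<noteq> y \<Longrightarrow> \<exists>n. dist (?T n x) (?T n y) > c"
    using assms(3) unfolding expansive_def by blast
  obtain d where d: "d > 0" "\<And>p q. p \<in> F \<Longrightarrow> q \<in> F \<Longrightarrow> p \<noteq> q \<Longrightarrow> d \<le> dist p q"
  proof -
    let ?D = "insert 1 ((\<lambda>(p, q). dist p q) ` {(p, q) \<in> F \<times> F. p \<noteq> q})"
    have fin: "finite ?D"
      using F(1) by (intro finite.insertI finite_imageI finite_subset[OF _ finite_cartesian_product]) auto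
    have pos: "0 < Min ?D" using fin by (subst Min_gr_iff) auto
    have "Min ?D \<le> dist p q" if "p \<in> F" "q \<in> F" "p \<noteq> q" for p q
      by (rule Min_le[OF fin]) (use that in force)
    with pos that show ?thesis by blast
  qed
  have "uniformly_continuous_on X f"
    using assms(1,2) by (simp add: compact_uniformly_continuous homeomorphism_def)
  then obtain s where s: "s > 0"
    "\<And>x y. x \<in> X \<Longrightarrow> y \<in> X \<Longrightarrow> dist x y < s \<Longrightarrow> dist (f x) (f y) < d / 2"
    unfolding uniformly_continuous_on_def using d(1) by (metis half_gt_zero dist_commute)
  \<comment> \<open>The bound \<open>d / 2\<close> makes the nearby point of \<open>F\<close> unique, \<open>s\<close> carries nearness over to the next
    time, and \<open>c\<close> lets expansiveness apply.\<close>
  define r where "r = min c (min s (d / 2))"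
  have r: "r > 0" "r \<le> c" "r \<le> s" "r \<le> d / 2" using c(1) s(1) d(1) by (auto simp: r_def)
  have "y \<in> F" if y: "y \<in> X" "\<And>n. \<exists>p\<in>F. dist (?T n y) p < r" for y
  proof -
    obtain p where p: "p \<in> F" "dist y p < r" using y(2)[of 0] by auto
    have pX: "p \<in> X" using p F(2) by blast
    have near: "q = q'" if "q \<in> F" "q' \<in> F" "dist z q < d / 2" "dist z q' < d / 2" for z q q'
      using d(2)[OF that(1,2)] that(3,4) dist_triangle3[of q q' z] by force
    \<comment> \<open>The orbit of \<open>y\<close> has to follow the orbit of \<open>p\<close>: at each time the point of \<open>F\<close> that is
      near is determined by its neighbour in time.\<close>
    have "dist (?T n y) (?T n p) < r" for n
    proof (induction n rule: int_induct[of _ 0])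
      case base then show ?case using p by simp
    next
      case (step1 n)
      obtain q where q: "q \<in> F" "dist (?T (n + 1) y) q < r" using y(2) by blast
      have "dist (?T (n + 1) y) (?T (n + 1) p) < d / 2"
        using s(2)[of "?T n y" "?T n p"] step1 r(3) memX y pX
        by (simp add: int_iterate_add1[OF bij])
      then have "q = ?T (n + 1) p"
        by (intro near[OF q(1) memF[OF p(1)], of "?T (n + 1) y"]) (use q(2) r(4) in linarith)+
      with q show ?case by simp
    next
      case (step2 n)
      obtain q where q: "q \<in> F" "dist (?T (n - 1) y) q < r" using y(2) by blast
      have qX: "q \<in> X" using q F(2) by blast
      have step: "?T n z = f (?T (n - 1) z)" if "z \<in> X" for z
        using int_iterate_add1[OF bij that, of "n - 1"] by simp
      have "dist (?T n y) (f q) < d / 2"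
        using s(2)[of "?T (n - 1) y" q] q(2) r(3) memX y qX by (simp add: step)
      then have "f q = ?T n p"
        using near[of "f q" "?T n p" "?T n y"] q(1) step2 memF p r(4) F(3) by auto
      then have "q = ?T (n - 1) p"
        using step[OF pX] bij qX memX[OF pX] by (metis bij_betw_def inj_onD)
      with q show ?case by simp
    qed
    then have "y = p" using c(2)[OF y(1) pX] r(2) by (meson less_le_trans not_less_iff_gr_or_eq)
    with p show ?thesis by simp
  qed
  with r(1) show ?thesis by blast
qed

definition infinite_subsystem :: "'a::metric_space set \<Rightarrow> ('a \<Rightarrow> 'a) \<Rightarrow> 'a set \<Rightarrow> bool" where
  "infinite_subsystem X f Y \<longleftrightarrow> closed Y \<and> Y \<subseteq> X \<and> f ` Y = Y \<and> infinite Y"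

text \<open>
  Only infiniteness is at stake. Were the intersection finite, compactness would put a whole member
  of the chain into a small neighbourhood of it, and since that member is invariant, its orbits would
  stay there and the previous lemma would make the member finite.
\<close>
lemma infinite_subsystem_Inter:
  fixes X :: "'a::metric_space set"
  assumes "compact X" "homeomorphism X X f g" "expansive X f"
    and \<C>: "\<C> \<noteq> {}" "\<And>Y. Y \<in> \<C> \<Longrightarrow> infinite_subsystem X f Y"
    and chain: "\<And>Y Z. Y \<in> \<C> \<Longrightarrow> Z \<in> \<C> \<Longrightarrow> Y \<subseteq> Z \<or> Z \<subseteq> Y"
  shows "infinite_subsystem X f (\<Inter>\<C>)"
proof -
  let ?F = "\<Inter>\<C>"
  note bij = homeomorphism_imp_bij_betw[OF assms(2)]
  have FX: "?F \<subseteq> X" using \<C> unfolding infinite_subsystem_def by blast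
  have inv: "f ` ?F = ?F"
  proof -
    obtain Y0 where Y0: "Y0 \<in> \<C>" using \<C>(1) by blast
    have "f ` (\<Inter>Y\<in>\<C>. Y) = (\<Inter>Y\<in>\<C>. f ` Y)"
      by (rule image_INT[of f X]) (use bij \<C> Y0 in \<open>auto simp: bij_betw_def infinite_subsystem_def\<close>)
    also have "\<dots> = ?F" using \<C>(2) by (auto simp: infinite_subsystem_def)
    finally show ?thesis by simp
  qed
  have "infinite ?F"
  proof
    assume fin: "finite ?F"
    obtain r where r: "r > 0"
      "\<And>y. y \<in> X \<Longrightarrow> (\<And>n. \<exists>p\<in>?F. dist (int_iterate X f n y) p < r) \<Longrightarrow> y \<in> ?F"
      using expansive_isolates_finite_invariant_set[OF assms(1-3) fin FX inv] by blast
    let ?U = "\<Union>p\<in>?F. ball p r"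
    have "compact (X - ?U)" using assms(1) by (intro compact_diff) auto
    moreover have "(X - ?U) \<inter> ?F = {}" using r(1) by force
    ultimately obtain Y where Y: "Y \<in> \<C>" "(X - ?U) \<inter> Y = {}"
      using compact_chain_disjoint[OF _ \<C>(1) _ chain] \<C>(2)
      by (metis infinite_subsystem_def)
    have sub: "infinite_subsystem X f Y" using \<C> Y by blast
    have "y \<in> ?F" if y: "y \<in> Y" for y
    proof (rule r(2))
      show "y \<in> X" using sub y by (auto simp: infinite_subsystem_def)
      fix n
      have "int_iterate X f n y \<in> Y"
        using int_iterate_mem[OF bij] sub y by (auto simp: infinite_subsystem_def)
      then have "int_iterate X f n y \<in> ?U"
        using sub Y(2) unfolding infinite_subsystem_def by blast
      then show "\<exists>p\<in>?F. dist (int_iterate X f n y) p < r"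
        by (auto simp: dist_commute)
    qed
    then have "Y \<subseteq> ?F" by blast
    then have "finite Y" using fin by (rule finite_subset)
    then show False using sub by (simp add: infinite_subsystem_def)
  qed
  then show ?thesis
    using inv FX \<C> by (auto simp: infinite_subsystem_def intro!: closed_Inter)
qed

lemma minimal_infinite_subsystem:
  fixes X :: "'a::metric_space set"
  assumes "compact X" "infinite X" "homeomorphism X X f g" "expansive X f"
  obtains M where "infinite_subsystem X f M"
    and "\<And>Y. infinite_subsystem X f Y \<Longrightarrow> Y \<subseteq> M \<Longrightarrow> Y = M"
proof -
  \<comment> \<open>Zorn's lemma yields maximal elements, so it is applied to the complements.\<close>
  let ?A = "{Z. infinite_subsystem X f (- Z)}"
  have X: "infinite_subsystem X f X"
    using assms by (auto simp: infinite_subsystem_def compact_imp_closed homeomorphism_def)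
  have "\<exists>M\<in>?A. \<forall>Z\<in>?A. M \<subseteq> Z \<longrightarrow> Z = M"
  proof (rule subset_Zorn_nonempty)
    show "?A \<noteq> {}" using X by (metis (mono_tags) double_compl empty_iff mem_Collect_eq)
  next
    fix \<C> assume \<C>: "\<C> \<noteq> {}" "subset.chain ?A \<C>"
    have "infinite_subsystem X f (\<Inter>(uminus ` \<C>))"
    proof (rule infinite_subsystem_Inter[OF assms(1,3,4)])
      show "uminus ` \<C> \<noteq> {}" using \<C>(1) by blast
      show "infinite_subsystem X f Y" if "Y \<in> uminus ` \<C>" for Y
        using that \<C>(2) by (auto simp: subset_chain_def)
      show "Y \<subseteq> Z \<or> Z \<subseteq> Y" if "Y \<in> uminus ` \<C>" "Z \<in> uminus ` \<C>" for Y Z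
        using that \<C>(2) unfolding subset_chain_def by auto
    qed
    then show "\<Union>\<C> \<in> ?A" by (simp add: uminus_Sup)
  qed
  then obtain Z where Z: "infinite_subsystem X f (- Z)"
    "\<And>W. infinite_subsystem X f (- W) \<Longrightarrow> Z \<subseteq> W \<Longrightarrow> W = Z" by blast
  have "Y = - Z" if "infinite_subsystem X f Y" "Y \<subseteq> - Z" for Y
    using Z(2)[of "- Y"] that by auto
  with Z(1) that show ?thesis by blast
qed

text \<open>
  The orbit of a periodic isolated point is a finite set of isolated points, because \<open>f\<close> preserves
  the set of limit points. Removing it leaves an infinite closed invariant set, contrary to
  minimality.
\<close>
lemma minimal_infinite_subsystem_isolated_nonperiodic:
  fixes X :: "'a::metric_space set"
  assumes hom: "homeomorphism X X f g" and M: "infinite_subsystem X f M"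
    and min: "\<And>Y. infinite_subsystem X f Y \<Longrightarrow> Y \<subseteq> M \<Longrightarrow> Y = M"
    and x: "x \<in> M" "\<not> x islimpt M" and k: "k > 0"
  shows "(f ^^ k) x \<noteq> x"
proof
  assume per: "(f ^^ k) x = x"
  let ?L = "{x \<in> M. x islimpt M}"
  have MX: "closed M" "M \<subseteq> X" "f ` M = M" "infinite M"
    using M unfolding infinite_subsystem_def by blast+
  have homM: "homeomorphism M M f g"
    using homeomorphism_restrict_invariant[OF hom MX(2,3)] .
  have inj: "inj_on f M" using homeomorphism_imp_bij_betw[OF homM] by (rule bij_betw_imp_inj_on)
  have fL: "f ` ?L = ?L" by (rule homeomorphism_limit_points[OF homM])
  define Orb where "Orb = (\<lambda>j. (f ^^ j) x) ` {..<k}"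
  have iso: "(f ^^ j) x \<in> M - ?L" for j
  proof (induction j)
    case (Suc j)
    have "f ` (M - ?L) = f ` M - f ` ?L" by (rule inj_on_image_set_diff[OF inj]) auto
    also have "\<dots> = M - ?L" by (simp only: fL MX(3))
    finally have eq: "f ` (M - ?L) = M - ?L" .
    have "f ((f ^^ j) x) \<in> f ` (M - ?L)" using Suc by (rule imageI)
    then show ?case by (simp only: eq funpow.simps comp_apply)
  qed (use x in auto)
  have OM: "Orb \<subseteq> M - ?L" using iso by (auto simp: Orb_def)
  \<comment> \<open>Applying \<open>f\<close> shifts the exponents \<open>0, ..., k - 1\<close> to \<open>1, ..., k\<close>, and periodicity identifies
    the exponents \<open>k\<close> and \<open>0\<close>.\<close>
  have "f ` Orb = Orb"
  proof -
    have "f ` Orb = (\<lambda>j. (f ^^ j) x) ` (Suc ` {..<k})" by (force simp: Orb_def)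
    also have "\<dots> = (\<lambda>j. (f ^^ j) x) ` insert k {Suc 0..<k}"
      using k by (intro arg_cong[where f = "image _"]) (auto simp: image_Suc_lessThan)
    also have "\<dots> = (\<lambda>j. (f ^^ j) x) ` insert 0 {Suc 0..<k}" using per by simp
    also have "insert 0 {Suc 0..<k} = {..<k}" using k by auto
    finally show ?thesis by (simp add: Orb_def)
  qed
  moreover have "f ` (M - Orb) = f ` M - f ` Orb"
    by (rule inj_on_image_set_diff[OF inj]) (use OM in auto)
  ultimately have inv: "f ` (M - Orb) = M - Orb" by (simp only: MX(3))
  \<comment> \<open>A limit point of \<open>M - Orb\<close> is a limit point of \<open>M\<close>, hence not one of the isolated points
    in \<open>Orb\<close>.\<close>
  have "closed (M - Orb)"
    unfolding closed_limpt
  proof (intro allI impI)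
    fix z assume "z islimpt (M - Orb)"
    then have "z islimpt M" by (meson Diff_subset islimpt_subset)
    then show "z \<in> M - Orb" using MX(1) OM closed_limpt by blast
  qed
  moreover have "infinite (M - Orb)" using MX(4) by (simp add: Orb_def)
  moreover have "M - Orb \<subseteq> X" using MX(2) by blast
  ultimately have "infinite_subsystem X f (M - Orb)"
    using inv by (simp add: infinite_subsystem_def)
  then have "M - Orb = M" using min by blast
  moreover have "x \<in> Orb" using k unfolding Orb_def by (metis funpow_0 image_eqI lessThan_iff)
  ultimately show False using x by blast
qed

section \<open>Doubly-asymptotic points\<close>

text \<open>
  Choose \<open>m\<close> such that \<open>f\<^sup>m\<close> fixes every limit point of \<open>M\<close>. When \<open>f\<^sup>n x\<close> is near a limit point \<open>p\<close>, so
  is \<open>f\<^sup>m (f\<^sup>n x)\<close>, by continuity of \<open>f\<^sup>m\<close>; here \<open>p\<close> may vary with \<open>n\<close>. All but finitely many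
  integers \<open>n\<close> qualify, because the nonperiodic orbit of \<open>x\<close> is injective; this covers both time
  directions at once.
\<close>
lemma finite_limit_points_imp_doubly_asymptotic:
  fixes X :: "'a::metric_space set"
  assumes "compact X" and hom: "homeomorphism X X f g" and M: "infinite_subsystem X f M"
    and L: "finite {x \<in> M. x islimpt M}"
    and x: "x \<in> M" and nonper: "\<And>k. k > 0 \<Longrightarrow> (f ^^ k) x \<noteq> x"
  shows "\<exists>m>0. doubly_asymptotic X f x ((f ^^ m) x)"
proof -
  let ?L = "{x \<in> M. x islimpt M}" and ?T = "int_iterate X f"
  note bij = homeomorphism_imp_bij_betw[OF hom]
  have MX: "closed M" "M \<subseteq> X" "f ` M = M"
    using M unfolding infinite_subsystem_def by blast+
  have compM: "compact M" using MX assms(1) by (metis compact_Int_closed inf.absorb2)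
  have homM: "homeomorphism M M f g"
    using homeomorphism_restrict_invariant[OF hom MX(2,3)] .
  have inj: "inj_on f M" using homeomorphism_imp_bij_betw[OF homM] by (rule bij_betw_imp_inj_on)
  obtain m where m: "m > 0" "\<And>p. p \<in> ?L \<Longrightarrow> (f ^^ m) p = p"
    using funpow_fixes_finite_set[OF L inj_on_subset[OF inj] homeomorphism_limit_points[OF homM]]
    by blast
  have "(f ^^ j) ` M \<subseteq> M \<and> continuous_on M (f ^^ j)" for j
  proof (induction j)
    case (Suc j)
    have "continuous_on ((f ^^ j) ` M) f"
      using Suc homeomorphism_cont1[OF homM] continuous_on_subset by blast
    then have "continuous_on M (f ^^ Suc j)"
      using Suc continuous_on_compose by auto
    then show ?case using Suc MX(3) by auto
  qed auto
  then have uc: "uniformly_continuous_on M (f ^^ m)"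
    using compM compact_uniformly_continuous by blast
  have TM: "?T n x \<in> M" for n using int_iterate_mem[OF bij MX(2,3) x] .
  have xX: "x \<in> X" using x MX by blast
  let ?D = "\<lambda>n. dist (?T n x) (?T n ((f ^^ m) x))"
  have fin: "finite {n. \<not> ?D n < e}" if e: "e > 0" for e
  proof -
    obtain s where s: "s > 0"
      "\<And>y z. y \<in> M \<Longrightarrow> z \<in> M \<Longrightarrow> dist y z < s \<Longrightarrow> dist ((f ^^ m) y) ((f ^^ m) z) < e / 2"
      using uc e unfolding uniformly_continuous_on_def by (metis half_gt_zero)
    define r where "r = min s (e / 2)"
    have r: "r > 0" "r \<le> s" "r \<le> e / 2" using s e by (auto simp: r_def)
    let ?U = "\<Union>p\<in>?L. ball p r"
    have "compact (M - ?U)" using compM by (intro compact_diff) auto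
    \<comment> \<open>Infinitely many points of \<open>M\<close> away from its limit points would accumulate at another one.\<close>
    have "finite (M - ?U)"
    proof (rule ccontr)
      assume "infinite (M - ?U)"
      then obtain z where z: "z \<in> M - ?U" "z islimpt (M - ?U)"
        using \<open>compact (M - ?U)\<close> compact_eq_Bolzano_Weierstrass by blast
      then have "z \<in> ?L" using islimpt_subset[of z "M - ?U" M] by auto
      then show False using z r(1) by force
    qed
    then have fin: "finite ((\<lambda>n. ?T n x) -` (M - ?U))"
      by (rule finite_vimageI) (rule inj_int_iterate_orbit[OF bij xX nonper])
    have "?D n < e" if "?T n x \<in> ?U" for n
    proof -
      from that obtain p where p: "p \<in> ?L" "dist (?T n x) p < r" by (auto simp: dist_commute)
      have "dist ((f ^^ m) (?T n x)) p < e / 2"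
        using s(2)[of "?T n x" p] p r(2) TM m(2)[OF p(1)] by auto
      then have "?D n < r + e / 2"
        using p(2) dist_triangle2[of "?T n x" "(f ^^ m) (?T n x)" p]
        by (simp add: int_iterate_commute[OF bij xX])
      with r(3) show ?thesis by simp
    qed
    then have "{n. \<not> ?D n < e} \<subseteq> (\<lambda>n. ?T n x) -` (M - ?U)" using TM by blast
    then show ?thesis using fin by (rule finite_subset)
  qed
  have "(?D \<longlongrightarrow> 0) cofinite"
    by (rule tendstoI) (use fin in \<open>auto simp: eventually_cofinite\<close>)
  moreover have "(at_top :: int filter) \<le> cofinite" "(at_bot :: int filter) \<le> cofinite"
  proof -
    have "eventually P at_top \<and> eventually P at_bot" if "eventually P cofinite" for P :: "int \<Rightarrow> bool"
    proof -
      have fin: "finite {n. \<not> P n}" using that by (simp add: eventually_cofinite)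
      have "P n" if "n > Max (insert 0 {n. \<not> P n})" for n
        using fin that by (metis Max_ge finite_insert insertCI leD mem_Collect_eq)
      moreover have "P n" if "n < Min (insert 0 {n. \<not> P n})" for n
        using fin that by (metis Min_le finite_insert insertCI leD mem_Collect_eq)
      ultimately show ?thesis
        unfolding eventually_at_top_dense eventually_at_bot_dense by blast
    qed
    then show "(at_top :: int filter) \<le> cofinite" "(at_bot :: int filter) \<le> cofinite"
      by (auto simp: le_filter_def)
  qed
  ultimately show ?thesis
    using m(1) unfolding doubly_asymptotic_def by (blast intro: tendsto_mono)
qed

theorem theorem5p1:
  fixes X :: "'a::metric_space set" and f :: "'a \<Rightarrow> 'a"
  assumes "compact X" and "infinite X"
    and "self_homeomorphism X f" and "expansive X f"
    and "countable X"
  shows "\<exists>x\<in>X. \<exists>y\<in>X. x \<noteq> y \<and> doubly_asymptotic X f x y"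
proof -
  obtain g where hom: "homeomorphism X X f g"
    using assms(3) unfolding self_homeomorphism_def by blast
  obtain M where M: "infinite_subsystem X f M"
    and min: "\<And>Y. infinite_subsystem X f Y \<Longrightarrow> Y \<subseteq> M \<Longrightarrow> Y = M"
    using minimal_infinite_subsystem[OF assms(1,2) hom assms(4)] by blast
  let ?L = "{x \<in> M. x islimpt M}"
  have MX: "closed M" "M \<subseteq> X" "f ` M = M" "infinite M"
    using M unfolding infinite_subsystem_def by blast+
  have compM: "compact M" using MX assms(1) by (metis compact_Int_closed inf.absorb2)
  obtain x where x: "x \<in> M" "\<not> x islimpt M"
    using countable_compact_isolated_point[OF compM] assms(5) MX
    by (metis countable_subset finite.emptyI)
  have nonper: "(f ^^ k) x \<noteq> x" if "k > 0" for k
    using minimal_infinite_subsystem_isolated_nonperiodic[OF hom M min x that] .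
  have "f ` ?L = ?L"
    using homeomorphism_limit_points homeomorphism_restrict_invariant[OF hom MX(2,3)] by blast
  moreover have "closed ?L"
  proof -
    have "?L = M \<inter> {x. x islimpt M}" by blast
    then show ?thesis using MX(1) closed_limpts by (metis closed_Int)
  qed
  moreover have "?L \<subseteq> X" using MX(2) by blast
  ultimately have "infinite_subsystem X f ?L" if "infinite ?L"
    using that unfolding infinite_subsystem_def by blast
  then have "finite ?L" using min[of ?L] x by blast
  then obtain m where m: "m > 0" "doubly_asymptotic X f x ((f ^^ m) x)"
    using finite_limit_points_imp_doubly_asymptotic[OF assms(1) hom M _ x(1) nonper] by blast
  have "(f ^^ m) x \<in> X"
  proof -
    have "(f ^^ j) x \<in> M" for j using x(1) MX(3) by (induction j) auto
    then show ?thesis using MX(2) by blast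
  qed
  then show ?thesis using m nonper[OF m(1)] x(1) MX(2) by (metis subsetD)
qed

end
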